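(* There is an absolute constant $C>0$ such that for every DAG $G$ on $\{1,\dots,K\}$ that has a single root node (i.e. exactly one node without parents), if $d\ge3$ and $n\ge8$, $$\inf_{E_n}\sup_{\mu\in\mathcal{P}_G}\int\mathcal{W}(E_n,\mu)\,d\mu^{\otimes n}\ge C\,n^{-1/d},$$ where the infimum ranges over all measurable maps $E_n:([0,1]^d)^n\to\mathcal{P}([0,1]^d)$.
   Context: $G$ is a directed acyclic graph with nodes $\{1,\dots,K\}$, topologically sorted (every edge $i\to j$ has $i<j$), and $\mathrm{pa}(k)$ is the set of parents of $k$. $[0,1]^d=\mathcal{X}_1\times\dots\times\mathcal{X}_K$ with $\mathcal{X}_k=[0,1]^{d_k}$, $\sum_{k=1}^Kd_k=d$. $\mathcal{P}_G$ is the set of Borel probability measures $\mu$ on $[0,1]^d$ with $\mu(dx)=\prod_{k=1}^K\mu(dx_k\mid x_{\mathrm{pa}(k)})$, where $\mu(dx_k\mid x_{\mathrm{pa}(k)})$ is the regular conditional distribution of the $k$-th variable given its parent variables (the $k$-th marginal if $\mathrm{pa}(k)=\emptyset$). $\mathcal{W}$ is the first-order Wasserstein distance with respect to the sup-norm. *)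

theory Defs
  imports "HOL-Probability.Probability"
begin

text \<open>
  The node set is \<open>{1..K}\<close>, \<open>G\<close> is the set of edges, and \<open>d k\<close> is the dimension of the factor
  \<open>[0,1]\<^bsup>d k\<^esup>\<close> attached to node \<open>k\<close>. Since the constant in the main result does not depend on
  the dimensions, these are natural numbers rather than types: a point \<open>x\<close> of \<open>[0,1]\<^bsup>d\<^esup>\<close> is a
  function with \<open>x k i\<close> the \<open>i\<close>-th coordinate of its \<open>k\<close>-th block, and \<open>\<Pi>\<^sub>M\<close> of the Borel spaces
  of \<open>[0,1]\<close> carries the Borel \<open>\<sigma>\<close>-algebra because the index sets are finite.
\<close>

definition topsorted_dag :: "nat \<Rightarrow> (nat \<times> nat) set \<Rightarrow> bool" where
  "topsorted_dag K G \<longleftrightarrow> G \<subseteq> {1..K} \<times> {1..K} \<and> (\<forall>(i, j)\<in>G. i < j)"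

lemma topsorted_dag_acyclic: "topsorted_dag K G \<Longrightarrow> acyclic G"
  by (rule acyclic_subset[OF wf_acyclic[OF wf_less]]) (auto simp: topsorted_dag_def)

definition pa :: "(nat \<times> nat) set \<Rightarrow> nat \<Rightarrow> nat set" where
  "pa G k = {i. (i, k) \<in> G}"

definition node_space :: "(nat \<Rightarrow> nat) \<Rightarrow> nat \<Rightarrow> (nat \<Rightarrow> real) measure" where
  "node_space d k = (\<Pi>\<^sub>M i\<in>{1..d k}. restrict_space borel {0..1})"

abbreviation block_space :: "(nat \<Rightarrow> nat) \<Rightarrow> nat set \<Rightarrow> (nat \<Rightarrow> nat \<Rightarrow> real) measure" where
  "block_space d I \<equiv> (\<Pi>\<^sub>M k\<in>I. node_space d k)"

abbreviation cube :: "nat \<Rightarrow> (nat \<Rightarrow> nat) \<Rightarrow> (nat \<Rightarrow> nat \<Rightarrow> real) measure" where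
  "cube K d \<equiv> block_space d {1..K}"

definition sup_dist ::
    "nat \<Rightarrow> (nat \<Rightarrow> nat) \<Rightarrow> (nat \<Rightarrow> nat \<Rightarrow> real) \<Rightarrow> (nat \<Rightarrow> nat \<Rightarrow> real) \<Rightarrow> real" where
  "sup_dist K d x y = (MAX (k, i)\<in>(SIGMA k:{1..K}. {1..d k}). \<bar>x k i - y k i\<bar>)"

text \<open>
  \<open>\<kappa>\<close> is a regular conditional distribution under \<open>\<mu>\<close> of the \<open>k\<close>-th block given the blocks in \<open>I\<close>.
  For \<open>I = {}\<close> the conditioning space is a single point, and \<open>\<kappa>\<close> is the \<open>k\<close>-th marginal.
\<close>

definition is_rcd :: "(nat \<Rightarrow> nat) \<Rightarrow> (nat \<Rightarrow> nat \<Rightarrow> real) measure \<Rightarrow> nat set \<Rightarrow> nat \<Rightarrow>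
    ((nat \<Rightarrow> nat \<Rightarrow> real) \<Rightarrow> (nat \<Rightarrow> real) measure) \<Rightarrow> bool" where
  "is_rcd d \<mu> I k \<kappa> \<longleftrightarrow>
     \<kappa> \<in> block_space d I \<rightarrow>\<^sub>M prob_algebra (node_space d k) \<and>
     (\<forall>A\<in>sets (block_space d I). \<forall>B\<in>sets (node_space d k).
        emeasure \<mu> {x \<in> space \<mu>. restrict x I \<in> A \<and> x k \<in> B} =
        (\<integral>\<^sup>+u\<in>A. emeasure (\<kappa> u) B \<partial>distr \<mu> (block_space d I) (\<lambda>x. restrict x I)))"

text \<open>
  The measure \<open>\<Prod>\<^sub>j \<kappa> j (x\<^bsub>pa(j)\<^esub>, dx\<^sub>j)\<close> on the first \<open>k\<close> blocks, by successive composition;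
  the topological order makes \<open>pa(k + 1) \<subseteq> {1..k}\<close>.
\<close>

primrec kernel_prod :: "(nat \<times> nat) set \<Rightarrow> (nat \<Rightarrow> nat) \<Rightarrow>
    (nat \<Rightarrow> (nat \<Rightarrow> nat \<Rightarrow> real) \<Rightarrow> (nat \<Rightarrow> real) measure) \<Rightarrow> nat \<Rightarrow> (nat \<Rightarrow> nat \<Rightarrow> real) measure" where
  "kernel_prod G d \<kappa> 0 = return (block_space d {}) (\<lambda>_. undefined)"
| "kernel_prod G d \<kappa> (Suc k) =
     kernel_prod G d \<kappa> k \<bind> (\<lambda>x. distr (\<kappa> (Suc k) (restrict x (pa G (Suc k))))
                                     (block_space d {1..Suc k}) (\<lambda>y. x(Suc k := y)))"

definition P_dag :: "nat \<Rightarrow> (nat \<times> nat) set \<Rightarrow> (nat \<Rightarrow> nat) \<Rightarrow> (nat \<Rightarrow> nat \<Rightarrow> real) measure set" where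
  "P_dag K G d = {\<mu> \<in> space (prob_algebra (cube K d)).
     \<exists>\<kappa>. (\<forall>k\<in>{1..K}. is_rcd d \<mu> (pa G k) k (\<kappa> k)) \<and> \<mu> = kernel_prod G d \<kappa> K}"

definition couplings :: "'a measure \<Rightarrow> 'a measure \<Rightarrow> 'a measure \<Rightarrow> ('a \<times> 'a) measure set" where
  "couplings M \<mu> \<nu> =
     {\<pi> \<in> space (prob_algebra (M \<Otimes>\<^sub>M M)). distr \<pi> M fst = \<mu> \<and> distr \<pi> M snd = \<nu>}"

definition wasserstein :: "nat \<Rightarrow> (nat \<Rightarrow> nat) \<Rightarrow>
    (nat \<Rightarrow> nat \<Rightarrow> real) measure \<Rightarrow> (nat \<Rightarrow> nat \<Rightarrow> real) measure \<Rightarrow> ennreal" where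
  "wasserstein K d \<mu> \<nu> =
     (INF \<pi>\<in>couplings (cube K d) \<mu> \<nu>. \<integral>\<^sup>+(x, y). ennreal (sup_dist K d x y) \<partial>\<pi>)"

text \<open>
  The \<open>\<sigma>\<close>-algebra of \<^const>\<open>prob_algebra\<close>, generated by the evaluations \<open>\<mu> \<mapsto> \<mu> A\<close>, is the
  Borel \<open>\<sigma>\<close>-algebra of the weak topology, as the cube is a compact metric space.
\<close>

definition estimators ::
    "nat \<Rightarrow> (nat \<Rightarrow> nat) \<Rightarrow> nat \<Rightarrow>
     ((nat \<Rightarrow> nat \<Rightarrow> nat \<Rightarrow> real) \<Rightarrow> (nat \<Rightarrow> nat \<Rightarrow> real) measure) set" where
  "estimators K d n = (\<Pi>\<^sub>M m\<in>{1..n}. cube K d) \<rightarrow>\<^sub>M prob_algebra (cube K d)"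

end

theory Submission
  imports Defs
begin

text \<open>
  Assouad's method. Choose \<open>4 * n\<close> points of the cube at mutual distance of order \<open>n\<^bsup>-1/D\<^esup>\<close>, where \<open>D\<close> is
  the dimension, perturbed so that each single coordinate identifies the point. Under a measure
  carried by such points every block is a function of any other block, so the measure factorizes along
  every DAG with a single root. Group the points into \<open>2 * n\<close> pairs and let \<open>\<mu>\<^sub>T\<close> be uniform on a choice \<open>T\<close>
  of one point per pair. A sample of size \<open>n\<close> says nothing about the choice in at least \<open>n\<close> pairs, and
  flipping the choice in these pairs moves half of the mass by the mutual distance; averaging over
  \<open>T\<close> gives the bound.
\<close>

section \<open>Measurability and the sup-distance on the cube\<close>

lemma measurable_coordinate:
  assumes "k \<in> I" "i \<in> {1..d k}"
  shows "(\<lambda>x. x k i) \<in> borel_measurable (block_space d I)"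
proof -
  have block: "(\<lambda>x. x k) \<in> block_space d I \<rightarrow>\<^sub>M node_space d k"
    using assms(1) by (rule measurable_component_singleton)
  have coord: "(\<lambda>y. y i) \<in> node_space d k \<rightarrow>\<^sub>M restrict_space borel {0..1::real}"
    unfolding node_space_def using assms(2) by (rule measurable_component_singleton)
  have incl: "(\<lambda>t. t) \<in> restrict_space borel {0..1::real} \<rightarrow>\<^sub>M borel"
    by (rule measurable_restrict_space1) (rule measurable_ident[unfolded id_def])
  show ?thesis
    by (rule measurable_compose[OF measurable_compose[OF block coord] incl])
qed

lemma singleton_sets_node_space:
  assumes "y \<in> space (node_space d k)"
  shows "{y} \<in> sets (node_space d k)"
proof -
  have "{y} = (\<Pi>\<^sub>E i\<in>{1..d k}. {y i})"
    using assms by (intro PiE_singleton[symmetric]) (auto simp: node_space_def space_PiM PiE_def)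
  also have "\<dots> \<in> sets (node_space d k)"
    unfolding node_space_def
    using assms by (intro sets_PiM_I_finite)
       (auto simp: sets_restrict_space_iff node_space_def space_PiM space_restrict_space PiE_def Pi_def)
  finally show ?thesis .
qed

text \<open>Makes single points of the cube measurable, so that the sampling measure can be
  evaluated on atoms.\<close>

lemma singleton_sets_block_space:
  assumes "x \<in> space (block_space d I)" "finite I"
  shows "{x} \<in> sets (block_space d I)"
proof -
  have "{x} = (\<Pi>\<^sub>E k\<in>I. {x k})"
    using assms by (intro PiE_singleton[symmetric]) (auto simp: space_PiM PiE_def)
  also have "\<dots> \<in> sets (block_space d I)"
    using assms by (intro sets_PiM_I_finite singleton_sets_node_space) (auto simp: space_PiM)
  finally show ?thesis .
qed

lemma sup_dist_altdef:
  "sup_dist K d x y = Max ((\<lambda>z. \<bar>x (fst z) (snd z) - y (fst z) (snd z)\<bar>) ` (SIGMA k:{1..K}. {1..d k}))"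
  by (simp add: sup_dist_def case_prod_beta)

lemma sup_dist_ge:
  assumes "k \<in> {1..K}" "i \<in> {1..d k}"
  shows "\<bar>x k i - y k i\<bar> \<le> sup_dist K d x y"
  unfolding sup_dist_altdef
  by (rule Max_ge) (use assms in \<open>auto intro!: rev_image_eqI[of "(k, i)"]\<close>)

lemma sup_dist_le:
  assumes "(SIGMA k:{1..K}. {1..d k}) \<noteq> {}"
    and "\<And>k i. k \<in> {1..K} \<Longrightarrow> i \<in> {1..d k} \<Longrightarrow> \<bar>x k i - y k i\<bar> \<le> r"
  shows "sup_dist K d x y \<le> r"
  unfolding sup_dist_altdef
  by (rule Max.boundedI) (use assms in auto)

lemma sup_dist_triangle:
  assumes "(SIGMA k:{1..K}. {1..d k}) \<noteq> {}"
  shows "sup_dist K d x z \<le> sup_dist K d x y + sup_dist K d y z"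
proof (rule sup_dist_le[OF assms])
  fix k i assume *: "k \<in> {1..K}" "i \<in> {1..d k}"
  show "\<bar>x k i - z k i\<bar> \<le> sup_dist K d x y + sup_dist K d y z"
    using sup_dist_ge[of k K i d x y, OF *] sup_dist_ge[of k K i d y z, OF *] by linarith
qed

lemma sup_dist_commute: "sup_dist K d x y = sup_dist K d y x"
  by (simp add: sup_dist_def abs_minus_commute)

lemma sup_dist_self:
  assumes "(SIGMA k:{1..K}. {1..d k}) \<noteq> {}"
  shows "sup_dist K d x x = 0"
  using assms unfolding sup_dist_altdef by (simp add: image_constant_conv)

lemma measurable_sup_dist:
  assumes "f \<in> M \<rightarrow>\<^sub>M cube K d" "g \<in> M \<rightarrow>\<^sub>M cube K d"
  shows "(\<lambda>w. sup_dist K d (f w) (g w)) \<in> borel_measurable M"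
  unfolding sup_dist_altdef
proof (intro borel_measurable_Max borel_measurable_abs borel_measurable_diff)
  fix z assume "z \<in> (SIGMA k:{1..K}. {1..d k})"
  then have *: "fst z \<in> {1..K}" "snd z \<in> {1..d (fst z)}" by auto
  show "(\<lambda>w. f w (fst z) (snd z)) \<in> borel_measurable M"
    by (rule measurable_compose[OF assms(1) measurable_coordinate[of "fst z" "{1..K}" "snd z" d, OF *]])
  show "(\<lambda>w. g w (fst z) (snd z)) \<in> borel_measurable M"
    by (rule measurable_compose[OF assms(2) measurable_coordinate[of "fst z" "{1..K}" "snd z" d, OF *]])
qed auto

section \<open>The Wasserstein distance: test functions and symmetry\<close>

text \<open>The easy half of Kantorovich-Rubinstein duality: integrated against a coupling, the
  Lipschitz inequality splits into the two marginals and the transport cost.\<close>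

lemma nn_integral_lipschitz_le_wasserstein:
  assumes [measurable]: "\<phi> \<in> borel_measurable (cube K d)"
    and lip: "\<And>x y. \<phi> y \<le> \<phi> x + ennreal (sup_dist K d x y)"
    and fin: "(\<integral>\<^sup>+x. \<phi> x \<partial>\<mu>) \<noteq> top"
  shows "(\<integral>\<^sup>+x. \<phi> x \<partial>\<nu>) \<le> (\<integral>\<^sup>+x. \<phi> x \<partial>\<mu>) + wasserstein K d \<mu> \<nu>"
proof -
  \<comment> \<open>In this form the right-hand side is the infimum itself, so each coupling can be
    treated separately; \<open>fin\<close> allows moving the subtracted integral back.\<close>
  have "(\<integral>\<^sup>+x. \<phi> x \<partial>\<nu>) - (\<integral>\<^sup>+x. \<phi> x \<partial>\<mu>) \<le> wasserstein K d \<mu> \<nu>"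
    unfolding wasserstein_def case_prod_unfold
  proof (rule INF_greatest)
    fix \<pi> assume "\<pi> \<in> couplings (cube K d) \<mu> \<nu>"
    then have [measurable_cong]: "sets \<pi> = sets (cube K d \<Otimes>\<^sub>M cube K d)"
      and \<mu>: "\<mu> = distr \<pi> (cube K d) fst" and \<nu>: "\<nu> = distr \<pi> (cube K d) snd"
      by (auto simp: couplings_def space_prob_algebra)
    have [measurable]: "(\<lambda>z. sup_dist K d (fst z) (snd z)) \<in> borel_measurable \<pi>"
      by (rule measurable_sup_dist) measurable
    have "(\<integral>\<^sup>+x. \<phi> x \<partial>\<nu>) = (\<integral>\<^sup>+z. \<phi> (snd z) \<partial>\<pi>)"
      unfolding \<nu> by (rule nn_integral_distr) measurable
    also have "\<dots> \<le> (\<integral>\<^sup>+z. \<phi> (fst z) + ennreal (sup_dist K d (fst z) (snd z)) \<partial>\<pi>)"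
      by (intro nn_integral_mono lip)
    also have "\<dots> = (\<integral>\<^sup>+z. \<phi> (fst z) \<partial>\<pi>) + (\<integral>\<^sup>+z. ennreal (sup_dist K d (fst z) (snd z)) \<partial>\<pi>)"
      by (rule nn_integral_add) measurable
    also have "(\<integral>\<^sup>+z. \<phi> (fst z) \<partial>\<pi>) = (\<integral>\<^sup>+x. \<phi> x \<partial>\<mu>)"
      unfolding \<mu> by (rule nn_integral_distr[symmetric]) measurable
    finally show "(\<integral>\<^sup>+x. \<phi> x \<partial>\<nu>) - (\<integral>\<^sup>+x. \<phi> x \<partial>\<mu>)
        \<le> (\<integral>\<^sup>+z. ennreal (sup_dist K d (fst z) (snd z)) \<partial>\<pi>)"
      using fin by (simp add: ennreal_minus_le_iff)
  qed
  then show ?thesis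
    using fin by (simp add: ennreal_minus_le_iff)
qed

text \<open>Swapping the components maps couplings of \<open>\<mu>\<close> and \<open>\<nu>\<close>
  to couplings of \<open>\<nu>\<close> and \<open>\<mu>\<close> at the same cost.\<close>

lemma wasserstein_commute: "wasserstein K d \<mu> \<nu> = wasserstein K d \<nu> \<mu>"
proof -
  have "wasserstein K d \<nu> \<mu> \<le> wasserstein K d \<mu> \<nu>" for \<mu> \<nu>
    unfolding wasserstein_def case_prod_unfold
  proof (rule INF_mono)
    fix \<pi> assume *: "\<pi> \<in> couplings (cube K d) \<mu> \<nu>"
    let ?C = "cube K d"
    from * have s[measurable_cong]: "sets \<pi> = sets (?C \<Otimes>\<^sub>M ?C)" and "prob_space \<pi>"
      and \<mu>: "\<mu> = distr \<pi> ?C fst" and \<nu>: "\<nu> = distr \<pi> ?C snd"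
      by (auto simp: couplings_def space_prob_algebra)
    let ?s = "\<lambda>z. (snd z, fst z)"
    let ?\<pi> = "distr \<pi> (?C \<Otimes>\<^sub>M ?C) ?s"
    have "(\<lambda>z. sup_dist K d (fst z) (snd z)) \<in> borel_measurable (?C \<Otimes>\<^sub>M ?C)"
      by (rule measurable_sup_dist) measurable
    then have dist: "(\<lambda>z. ennreal (sup_dist K d (fst z) (snd z))) \<in> borel_measurable (?C \<Otimes>\<^sub>M ?C)"
      by measurable
    have swap: "?s \<in> \<pi> \<rightarrow>\<^sub>M ?C \<Otimes>\<^sub>M ?C"
      by measurable
    have "prob_space ?\<pi>"
      by (rule prob_space.prob_space_distr[OF \<open>prob_space \<pi>\<close> swap])
    moreover have "distr ?\<pi> ?C fst = \<nu>" "distr ?\<pi> ?C snd = \<mu>"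
      unfolding \<mu> \<nu> distr_distr[OF measurable_fst swap] distr_distr[OF measurable_snd swap] comp_def
      by (simp_all only: fst_conv snd_conv)
    ultimately have "?\<pi> \<in> couplings ?C \<nu> \<mu>"
      by (simp add: couplings_def space_prob_algebra)
    moreover have "(\<integral>\<^sup>+z. ennreal (sup_dist K d (fst z) (snd z)) \<partial>?\<pi>)
        = (\<integral>\<^sup>+z. ennreal (sup_dist K d (fst z) (snd z)) \<partial>\<pi>)"
      by (subst nn_integral_distr[OF swap])
         (simp_all only: measurable_distr_eq1 dist fst_conv snd_conv sup_dist_commute)
    ultimately show "\<exists>\<pi>'\<in>couplings ?C \<nu> \<mu>. (\<integral>\<^sup>+z. ennreal (sup_dist K d (fst z) (snd z)) \<partial>\<pi>')
        \<le> (\<integral>\<^sup>+z. ennreal (sup_dist K d (fst z) (snd z)) \<partial>\<pi>)"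
      by (intro bexI[of _ ?\<pi>]) (simp_all only: order_refl)
  qed
  then show ?thesis by (intro antisym)
qed

section \<open>Integrals over atomic samples\<close>

text \<open>A simple function carried by the atoms \<open>g s\<close> lies below \<open>f\<close>
  and is measurable even when \<open>f\<close> is not. Thus the bound applies directly to the
  Wasserstein loss as a function of the sample.\<close>

lemma sum_le_nn_integral_PiM:
  assumes "finite J" "finite S"
    and "\<And>i. i \<in> J \<Longrightarrow> prob_space (M i)"
    and inj: "inj_on g S"
    and g: "\<And>s. s \<in> S \<Longrightarrow> g s \<in> space (PiM J M)"
    and single: "\<And>s i. s \<in> S \<Longrightarrow> i \<in> J \<Longrightarrow> {g s i} \<in> sets (M i)"
  shows "(\<Sum>s\<in>S. f (g s) * (\<Prod>i\<in>J. emeasure (M i) {g s i})) \<le> (\<integral>\<^sup>+\<omega>. f \<omega> \<partial>PiM J M)"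
proof -
  \<comment> \<open>\<open>product_prob_space\<close> asks for a probability measure at every index,
    so the family is extended by a one-point space outside \<open>J\<close>.\<close>
  define M' where "M' i = (if i \<in> J then M i else count_space {undefined})" for i
  have eq: "PiM J M = PiM J M'"
    by (rule PiM_cong) (auto simp: M'_def)
  have "prob_space (M' i)" for i
    using assms(3) by (auto simp: M'_def intro!: prob_spaceI)
  then interpret product_prob_space M'
    by (auto simp: product_prob_space_def product_sigma_finite_def product_prob_space_axioms_def
        prob_space_imp_sigma_finite)
  have S: "{g s} = (\<Pi>\<^sub>E i\<in>J. {g s i})" if "s \<in> S" for s
    using g[OF that] by (intro PiE_singleton[symmetric]) (auto simp: space_PiM PiE_def)
  have sets: "{g s} \<in> sets (PiM J M)" if "s \<in> S" for s
    unfolding S[OF that] using that assms by (intro sets_PiM_I_finite)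
  have em: "emeasure (PiM J M) {g s} = (\<Prod>i\<in>J. emeasure (M i) {g s i})" if "s \<in> S" for s
    unfolding S[OF that] eq using that single assms(1)
    by (subst emeasure_PiM) (auto simp: M'_def)
  have "(\<Sum>s\<in>S. f (g s) * (\<Prod>i\<in>J. emeasure (M i) {g s i}))
      = (\<Sum>s\<in>S. \<integral>\<^sup>+\<omega>. f (g s) * indicator {g s} \<omega> \<partial>PiM J M)"
    by (intro sum.cong refl) (simp add: em sets nn_integral_cmult_indicator)
  also have "\<dots> = (\<integral>\<^sup>+\<omega>. (\<Sum>s\<in>S. f (g s) * indicator {g s} \<omega>) \<partial>PiM J M)"
    by (rule nn_integral_sum[symmetric]) (use sets in measurable)
  also have "\<dots> \<le> (\<integral>\<^sup>+\<omega>. f \<omega> \<partial>PiM J M)"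
  proof (rule nn_integral_mono)
    fix \<omega>
    \<comment> \<open>At most one summand is nonzero at \<open>\<omega>\<close>, since
      \<open>g\<close> is injective on \<open>S\<close>.\<close>
    show "(\<Sum>s\<in>S. f (g s) * indicator {g s} \<omega>) \<le> f \<omega>"
    proof (cases "\<omega> \<in> g ` S")
      case True
      then obtain t where t: "t \<in> S" "\<omega> = g t" by auto
      have "(\<Sum>s\<in>S. f (g s) * indicator {g s} \<omega>) = (\<Sum>s\<in>S. if s = t then f (g s) else 0)"
        using t inj by (intro sum.cong refl) (auto simp: inj_on_eq_iff)
      then show ?thesis using t assms(2) by simp
    next
      case False
      then have "indicator {g s} \<omega> = (0::ennreal)" if "s \<in> S" for s
        using that by (auto simp: indicator_def)
      then show ?thesis by (simp add: sum.neutral)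
    qed
  qed
  finally show ?thesis .
qed

text \<open>Each induction step splits off the top digit: \<open>u mod (M ^ D * M)\<close> is
  \<open>M ^ D\<close> times digit number \<open>D\<close> plus \<open>u mod M ^ D\<close>. Serves
  to find a coordinate in which two grid cells differ.\<close>

lemma mod_power_eq_digits:
  fixes u v M :: nat
  assumes "\<And>t. t < D \<Longrightarrow> u div M ^ t mod M = v div M ^ t mod M"
  shows "u mod M ^ D = v mod M ^ D"
  using assms
proof (induction D)
  case (Suc D)
  then show ?case
    by (simp add: power_Suc2 mod_mult2_eq del: power_Suc)
qed auto

section \<open>Factorization along a DAG with a single root\<close>

lemma measurable_fun_upd_block:
  assumes "f \<in> M \<rightarrow>\<^sub>M block_space d {1..k}" "g \<in> M \<rightarrow>\<^sub>M node_space d (Suc k)"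
  shows "(\<lambda>w. (f w)(Suc k := g w)) \<in> M \<rightarrow>\<^sub>M block_space d {1..Suc k}"
proof -
  have eq: "{1..Suc k} = {1..k} \<union> {Suc k}" by auto
  show ?thesis
    unfolding eq by (rule measurable_fun_upd[OF refl assms])
qed

text \<open>Edges increase, so node 1 has no incoming edge and the unique root can only be node
  1.\<close>

lemma topsorted_dag_root:
  assumes "topsorted_dag K G" "\<exists>!k. k \<in> {1..K} \<and> pa G k = {}"
  shows "K \<ge> 1" "pa G 1 = {}" "\<And>k. k \<in> {1..K} \<Longrightarrow> pa G k = {} \<Longrightarrow> k = 1"
    "\<And>k. pa G (Suc k) \<subseteq> {1..k}"
proof -
  show K: "K \<ge> 1" using assms(2) by force
  show sub: "pa G (Suc k) \<subseteq> {1..k}" for k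
    using assms(1) unfolding topsorted_dag_def pa_def by fastforce
  show root: "pa G 1 = {}"
    using sub[of 0] by (simp del: One_nat_def add: One_nat_def[symmetric])
  show "k = 1" if "k \<in> {1..K}" "pa G k = {}" for k
  proof -
    from assms(2) obtain r where "\<And>j. j \<in> {1..K} \<and> pa G j = {} \<Longrightarrow> j = r" by blast
    then show ?thesis using that root K by (metis atLeastAtMost_iff order_refl)
  qed
qed

lemma restrict_fun_upd_Suc:
  "(restrict x {1..k})(Suc k := x (Suc k)) = restrict x {1..Suc k}"
  by (auto simp: fun_eq_iff restrict_def)

text \<open>The conditional kernels are deterministic except at the root.\<close>

lemma distr_in_P_dag:
  fixes q :: "nat pmf" and p :: "nat \<Rightarrow> nat \<Rightarrow> nat \<Rightarrow> real"
  assumes G: "topsorted_dag K G" "\<exists>!k. k \<in> {1..K} \<and> pa G k = {}"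
    and d: "\<And>k. k \<in> {1..K} \<Longrightarrow> d k \<ge> 1"
    and p: "\<And>u. p u \<in> space (cube K d)"
    and h: "h \<in> borel \<rightarrow>\<^sub>M count_space UNIV"
    and decode: "\<And>k u. k \<in> {1..K} \<Longrightarrow> p (h (p u k 1)) = p u"
  shows "distr (measure_pmf q) (cube K d) p \<in> P_dag K G d"
proof -
  let ?\<mu> = "distr (measure_pmf q) (cube K d) p"
  note root = topsorted_dag_root[OF G]
  have pk: "p u k \<in> space (node_space d k)" if "k \<in> {1..K}" for u k
    using p[of u] that by (auto simp: space_PiM)
  have pr: "restrict (p u) I \<in> space (block_space d I)" if "I \<subseteq> {1..K}" for u I
    using pk that by (auto simp: space_PiM)
  have pm: "p \<in> measure_pmf q \<rightarrow>\<^sub>M cube K d"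
    using p by simp
  have prob: "prob_space ?\<mu>"
    by (rule measure_pmf.prob_space_distr) (use p in auto)
  \<comment> \<open>Any parent block reveals the whole point: \<open>h\<close> decodes an index of
    it from the block's first coordinate, which exists since every block has positive
    dimension.\<close>
  define f where "f k x = p (h (x (SOME j. j \<in> pa G k) 1)) k" for k and x :: "nat \<Rightarrow> nat \<Rightarrow> real"
  define \<kappa> where "\<kappa> k = (if pa G k = {} then (\<lambda>x. distr (measure_pmf q) (node_space d k) (\<lambda>u. p u k))
      else (\<lambda>x. return (node_space d k) (f k x)))" for k
  have pa_sub: "pa G k \<subseteq> {1..<k}" if "k \<in> {1..K}" for k
    using root(4)[of "k - 1"] that by (auto dest!: subsetD)
  have some: "(SOME j. j \<in> pa G k) \<in> pa G k" if "pa G k \<noteq> {}" for k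
    using that by (simp add: some_in_eq)
  have f_meas: "f k \<in> block_space d (pa G k) \<rightarrow>\<^sub>M node_space d k" if "k \<in> {1..K}" "pa G k \<noteq> {}" for k
  proof -
    let ?j = "SOME j. j \<in> pa G k"
    have j: "?j \<in> pa G k" "1 \<in> {1..d ?j}"
      using some[OF that(2)] pa_sub[OF that(1)] that(1) d[of ?j] by auto
    have "(\<lambda>x. h (x ?j 1)) \<in> block_space d (pa G k) \<rightarrow>\<^sub>M count_space UNIV"
      by (rule measurable_compose[OF measurable_coordinate[of ?j _ 1] h]) (use j in auto)
    moreover have "(\<lambda>u. p u k) \<in> count_space UNIV \<rightarrow>\<^sub>M node_space d k"
      using pk[OF that(1)] by simp
    ultimately show ?thesis
      unfolding f_def[abs_def] by (rule measurable_compose)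
  qed
  have f_eq: "f k (restrict (p u) (pa G k)) = p u k" if "k \<in> {1..K}" "pa G k \<noteq> {}" for k u
    using some[OF that(2)] pa_sub[OF that(1)] that(1) decode[of "SOME j. j \<in> pa G k" u]
    by (auto simp: f_def)
  have \<kappa>_meas: "\<kappa> k \<in> block_space d (pa G k) \<rightarrow>\<^sub>M prob_algebra (node_space d k)" if k: "k \<in> {1..K}" for k
  proof (cases "pa G k = {}")
    case True
    have "distr (measure_pmf q) (node_space d k) (\<lambda>u. p u k) \<in> space (prob_algebra (node_space d k))"
      using pk[OF k] by (auto simp: space_prob_algebra intro!: measure_pmf.prob_space_distr)
    with True show ?thesis by (simp add: \<kappa>_def)
  next
    case False
    with f_meas[OF k] show ?thesis
      by (simp add: \<kappa>_def measurable_compose[OF _ measurable_return_prob_space])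
  qed
  have "is_rcd d ?\<mu> (pa G k) k (\<kappa> k)" if k: "k \<in> {1..K}" for k
    unfolding is_rcd_def
  proof (intro conjI \<kappa>_meas[OF k] ballI)
    fix A B assume A: "A \<in> sets (block_space d (pa G k))" and B: "B \<in> sets (node_space d k)"
    let ?I = "pa G k"
    have I: "?I \<subseteq> {1..K}" using pa_sub[OF k] k by auto
    have rest: "(\<lambda>x. restrict x ?I) \<in> cube K d \<rightarrow>\<^sub>M block_space d ?I"
      using I by (rule measurable_restrict_subset)
    have rest': "(\<lambda>u. restrict (p u) ?I) \<in> measure_pmf q \<rightarrow>\<^sub>M block_space d ?I"
      using pr[OF I] by simp
    have comp: "(\<lambda>x. x k) \<in> cube K d \<rightarrow>\<^sub>M node_space d k"
      using k by (rule measurable_component_singleton)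
    have set: "{x \<in> space (cube K d). restrict x ?I \<in> A \<and> x k \<in> B} \<in> sets (cube K d)"
    proof -
      have "{x \<in> space (cube K d). restrict x ?I \<in> A \<and> x k \<in> B}
        = ((\<lambda>x. restrict x ?I) -` A \<inter> space (cube K d)) \<inter> ((\<lambda>x. x k) -` B \<inter> space (cube K d))"
        by blast
      then show ?thesis
        using measurable_sets[OF rest A] measurable_sets[OF comp B] by (simp only: sets.Int)
    qed
    have "emeasure ?\<mu> {x \<in> space ?\<mu>. restrict x ?I \<in> A \<and> x k \<in> B}
        = emeasure (measure_pmf q) {u. restrict (p u) ?I \<in> A \<and> p u k \<in> B}"
      using set p by (subst emeasure_distr) (auto intro!: arg_cong[where f = "emeasure _"])
    \<comment> \<open>All integrals now run over the index \<open>u\<close>. At the root the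
      conditioning space is a single point and \<open>\<kappa> k\<close> is the marginal; elsewhere
      \<open>\<kappa> k\<close> is the point mass at \<open>p u k\<close> by
      \<open>f_eq\<close>.\<close>
    also have "\<dots> = (\<integral>\<^sup>+u. indicator A (restrict (p u) ?I) * emeasure (\<kappa> k (restrict (p u) ?I)) B \<partial>measure_pmf q)"
    proof (cases "?I = {}")
      case True
      have "emeasure (\<kappa> k (restrict (p u) ?I)) B = emeasure (measure_pmf q) {u. p u k \<in> B}" for u
        using True pk[OF k] B by (simp add: \<kappa>_def emeasure_distr vimage_def)
      then show ?thesis
        using True by (cases "(\<lambda>_. undefined) \<in> A") (simp_all add: restrict_def)
    next
      case False
      have "emeasure (\<kappa> k (restrict (p u) ?I)) B = indicator B (p u k)" for u
        using False B f_eq[OF k False] by (simp add: \<kappa>_def)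
      then have "(\<integral>\<^sup>+u. indicator A (restrict (p u) ?I) * emeasure (\<kappa> k (restrict (p u) ?I)) B \<partial>measure_pmf q)
        = (\<integral>\<^sup>+u. indicator {u. restrict (p u) ?I \<in> A \<and> p u k \<in> B} u \<partial>measure_pmf q)"
        by (intro nn_integral_cong) (auto simp: indicator_def)
      then show ?thesis by simp
    qed
    also have "\<dots> = (\<integral>\<^sup>+x. emeasure (\<kappa> k x) B * indicator A x \<partial>distr ?\<mu> (block_space d ?I) (\<lambda>x. restrict x ?I))"
    proof -
      have "(\<lambda>x. emeasure (\<kappa> k x) B) \<in> borel_measurable (block_space d ?I)"
        by (rule measurable_compose[OF measurable_prob_algebraD[OF \<kappa>_meas[OF k]]
              measurable_emeasure_subprob_algebra[OF B]])
      then show ?thesis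
        unfolding distr_distr[OF rest pm] comp_def
        using A by (simp add: nn_integral_distr[OF rest'] mult.commute)
    qed
    finally show "emeasure ?\<mu> {x \<in> space ?\<mu>. restrict x ?I \<in> A \<and> x k \<in> B} = \<dots>" .
  qed
  \<comment> \<open>The induction keeps one random index \<open>u\<close> for all blocks: every new
    block is appended as a function of what is already there.\<close>
  moreover have kernel_prod: "kernel_prod G d \<kappa> k = distr (measure_pmf q) (block_space d {1..k}) (\<lambda>u. restrict (p u) {1..k})"
    if "k \<le> K" for k
    using that
  proof (induction k)
    case 0
    show ?case
      by (rule measure_eqI) (auto simp: emeasure_distr space_PiM restrict_def indicator_def)
  next
    case (Suc k)
    let ?B = "block_space d {1..k}" and ?B' = "block_space d {1..Suc k}"
    let ?g = "\<lambda>x. distr (\<kappa> (Suc k) (restrict x (pa G (Suc k)))) ?B' (\<lambda>y. x(Suc k := y))"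
    have k: "Suc k \<in> {1..K}" using Suc.prems by simp
    have upd: "(\<lambda>(x, y). x(Suc k := y)) \<in> ?B \<Otimes>\<^sub>M node_space d (Suc k) \<rightarrow>\<^sub>M ?B'"
      unfolding case_prod_unfold by (rule measurable_fun_upd_block) measurable
    have g: "?g \<in> ?B \<rightarrow>\<^sub>M prob_algebra ?B'"
      by (rule measurable_distr_prob_space2[OF measurable_compose[OF measurable_restrict_subset[OF root(4)] \<kappa>_meas[OF k]] upd])
    have pB: "restrict (p u) {1..k} \<in> space ?B" for u
      by (rule pr) (use k in auto)
    have pB': "(\<lambda>u. restrict (p u) {1..Suc k}) \<in> measure_pmf q \<rightarrow>\<^sub>M ?B'"
      using pr[of "{1..Suc k}"] k by auto
    have rr: "restrict (restrict (p u) {1..k}) (pa G (Suc k)) = restrict (p u) (pa G (Suc k))" for u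
      using root(4)[of k] by (auto simp: fun_eq_iff restrict_def)
    have "kernel_prod G d \<kappa> (Suc k) = distr (measure_pmf q) ?B (\<lambda>u. restrict (p u) {1..k}) \<bind> ?g"
      by (simp only: kernel_prod.simps Suc.IH[OF Suc_leD[OF Suc.prems]])
    also have "\<dots> = measure_pmf q \<bind> (\<lambda>u. ?g (restrict (p u) {1..k}))"
      by (rule bind_distr[OF _ measurable_prob_algebraD[OF g]]) (use pB in auto)
    also have "\<dots> = distr (measure_pmf q) ?B' (\<lambda>u. restrict (p u) {1..Suc k})"
    proof (cases "pa G (Suc k) = {}")
      case True
      \<comment> \<open>Uniqueness of the root enters here: the index is drawn while no block exists
        yet. A later root would draw a second, independent index.\<close>
      with root(3)[OF k] have [simp]: "k = 0" by simp
      have pn: "(\<lambda>u. p u (Suc k)) \<in> measure_pmf q \<rightarrow>\<^sub>M node_space d (Suc k)"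
        using pk[OF k] by simp
      have un: "(\<lambda>y. (restrict (p u) {1..k})(Suc k := y)) \<in> node_space d (Suc k) \<rightarrow>\<^sub>M ?B'" for u
        using pB by (intro measurable_fun_upd_block) simp_all
      have e: "(restrict (p v) {1..k})(Suc k := p u (Suc k)) = restrict (p u) {1..Suc k}" for u v
        by (auto simp: fun_eq_iff restrict_def)
      have "?g (restrict (p v) {1..k}) = distr (measure_pmf q) ?B' (\<lambda>u. restrict (p u) {1..Suc k})" for v
        using True by (simp only: \<kappa>_def simp_thms if_True distr_distr[OF un pn] comp_def e)
      moreover have "prob_space (distr (measure_pmf q) ?B' (\<lambda>u. restrict (p u) {1..Suc k}))"
        by (rule measure_pmf.prob_space_distr[OF pB'])
      ultimately show ?thesis
        by (simp only: bind_const'[OF measure_pmf.prob_space_axioms prob_space_imp_subprob_space])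
    next
      case False
      have "?g (restrict (p u) {1..k}) = return ?B' (restrict (p u) {1..Suc k})" for u
      proof -
        have un: "(\<lambda>y. (restrict (p u) {1..k})(Suc k := y)) \<in> node_space d (Suc k) \<rightarrow>\<^sub>M ?B'"
          using pB by (intro measurable_fun_upd_block) simp_all
        show ?thesis
          using False pk[OF k] f_eq[OF k False]
          by (simp only: \<kappa>_def if_False rr distr_return[OF un] restrict_fun_upd_Suc)
      qed
      then show ?thesis
        using bind_return_distr'[OF _ pB'] by simp
    qed
    finally show ?case .
  qed
  have "kernel_prod G d \<kappa> K = ?\<mu>"
  proof -
    have "restrict (p u) {1..K} = p u" for u
      using p[of u] by (simp add: space_PiM PiE_restrict)
    with kernel_prod[of K] show ?thesis by simp
  qed
  ultimately show ?thesis
    unfolding P_dag_def using prob by (auto simp: space_prob_algebra intro!: exI[of _ \<kappa>])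
qed

section \<open>Separated points in the cube and laws carried by them\<close>

text \<open>For \<open>u < N\<close>, the base-\<open>M\<close> digits of \<open>u\<close> select a
  cell of the grid of side \<open>1 / M\<close>, and all coordinates get the same offset
  \<open>u / (2 * N * M)\<close> within the cell. The offset lets each coordinate reveal
  \<open>u\<close>; being below half a cell, it costs at most half of the separation.\<close>

lemma separated_grid_points:
  fixes K :: nat and d :: "nat \<Rightarrow> nat" and M N :: nat
  assumes "N > 0" "N \<le> M ^ (\<Sum>k=1..K. d k)" "(\<Sum>k=1..K. d k) > 0"
  shows "\<exists>p h. (\<forall>u. p u \<in> space (cube K d)) \<and> h \<in> borel \<rightarrow>\<^sub>M count_space UNIV \<and>
    (\<forall>u k i. k \<in> {1..K} \<longrightarrow> i \<in> {1..d k} \<longrightarrow> p (h (p u k i)) = p u) \<and>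
    (\<forall>u v. u < N \<longrightarrow> v < N \<longrightarrow> u \<noteq> v \<longrightarrow> 1 / (2 * real M) \<le> sup_dist K d (p u) (p v))"
proof -
  let ?D = "SIGMA k:{1..K}. {1..d k}"
  have M: "M > 0"
    using assms by (metis gr0I not_less zero_power)
  obtain pos where pos: "bij_betw pos ?D {0..<card ?D}"
    using ex_bij_betw_finite_nat[of ?D] by auto
  have card: "card ?D = (\<Sum>k=1..K. d k)"
    by simp
  \<comment> \<open>the coordinates of a grid cell, shifted by less than half a cell so that the remainder encodes \<open>u\<close>\<close>
  define c where "c u k i = (real (u mod N div M ^ pos (k, i) mod M) + real (u mod N) / (2 * N)) / M"
    for u k and i :: nat
  define p where "p u = (\<lambda>k\<in>{1..K}. \<lambda>i\<in>{1..d k}. c u k i)" for u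
  \<comment> \<open>Multiplying by \<open>M\<close> makes the cell position an integer, so the
    fractional part is \<open>(u mod N) / (2 * N)\<close> and scaling returns
    \<open>u mod N\<close>. As \<open>p\<close> depends only on this residue, that suffices to
    recover \<open>p u\<close>.\<close>
  define h where "h y = nat \<lfloor>2 * real N * frac (real M * y)\<rfloor>" for y :: real
  have half: "real (u mod N) / (2 * N) < 1 / 2" for u
    using assms(1) by (simp add: field_simps)
  have "c u k i \<in> {0..1}" for u k i
  proof -
    have "real (u mod N div M ^ pos (k, i) mod M) + 1 \<le> real M"
      using M by (metis Suc_eq_plus1 Suc_leI mod_less_divisor of_nat_1 of_nat_add of_nat_le_iff)
    then show ?thesis using half[of u] M by (simp add: c_def field_simps)
  qed
  then have p: "p u \<in> space (cube K d)" for u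
    by (auto simp: p_def space_PiM node_space_def space_restrict_space)
  have hp: "h (p u k i) = u mod N" if "k \<in> {1..K}" "i \<in> {1..d k}" for u k i
  proof -
    have "real M * p u k i = of_int (int (u mod N div M ^ pos (k, i) mod M)) + real (u mod N) / (2 * N)"
      using that M by (simp add: p_def c_def)
    then have "frac (real M * p u k i) = real (u mod N) / (2 * N)"
      using half[of u] by (simp only: frac_add_of_int_left) (simp add: frac_eq)
    then show ?thesis using assms(1) by (simp add: h_def)
  qed
  have "p (u mod N) = p u" for u
    by (simp add: p_def c_def)
  then have "p (h (p u k i)) = p u" if "k \<in> {1..K}" "i \<in> {1..d k}" for u k i
    using hp[OF that] by simp
  moreover have "h \<in> borel \<rightarrow>\<^sub>M count_space UNIV"
    unfolding h_def frac_def by measurable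
  moreover have "1 / (2 * real M) \<le> sup_dist K d (p u) (p v)" if uv: "u < N" "v < N" "u \<noteq> v" for u v
  proof -
    \<comment> \<open>Distinct numbers below \<open>M ^ card ?D\<close> differ in some digit, and
      \<open>pos\<close> turns this digit into a coordinate.\<close>
    obtain t where t: "t < card ?D" "u div M ^ t mod M \<noteq> v div M ^ t mod M"
      using mod_power_eq_digits[of "card ?D" u M v] uv assms(2) card by force
    have "t \<in> pos ` ?D"
      using t(1) pos by (simp only: bij_betw_def atLeastLessThan_iff zero_le simp_thms)
    then obtain k i where ki: "k \<in> {1..K}" "i \<in> {1..d k}" "pos (k, i) = t"
      by blast
    let ?a = "u div M ^ t mod M" and ?b = "v div M ^ t mod M"
    \<comment> \<open>The digits differ by at least 1, of which the offsets can cancel at most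
      1/2.\<close>
    have "1 \<le> \<bar>real ?a - real ?b\<bar>" using t(2) by linarith
    moreover have "\<bar>real u / (2 * N) - real v / (2 * N)\<bar> \<le> 1 / 2"
    proof -
      have "real u / (2 * N) < 1 / 2" "real v / (2 * N) < 1 / 2"
        using half[of u] half[of v] uv(1,2) by (simp_all only: mod_less)
      moreover have "0 \<le> real u / (2 * N)" "0 \<le> real v / (2 * N)"
        by simp_all
      ultimately show ?thesis by linarith
    qed
    ultimately have "1 / 2 \<le> \<bar>(real ?a + real u / (2 * N)) - (real ?b + real v / (2 * N))\<bar>"
      by linarith
    then have "1 / 2 / M \<le> \<bar>(real ?a + real u / (2 * N)) - (real ?b + real v / (2 * N))\<bar> / M"
      by (rule divide_right_mono) simp
    also have "\<dots> = \<bar>p u k i - p v k i\<bar>"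
      using ki uv M by (simp add: p_def c_def diff_divide_distrib[symmetric])
    also have "\<dots> \<le> sup_dist K d (p u) (p v)"
      by (rule sup_dist_ge) (use ki in auto)
    finally show ?thesis by simp
  qed
  ultimately show ?thesis using p by blast
qed

text \<open>
  The distance to the support of \<open>q2\<close> is a Lipschitz function that vanishes \<open>q2\<close>-almost surely, so it
  bounds the sum from below without a triangle inequality for the Wasserstein distance.
\<close>

lemma wasserstein_add_ge_separated:
  fixes q1 q2 :: "nat pmf"
  assumes D: "(SIGMA k:{1..K}. {1..d k}) \<noteq> {}"
    and p: "\<And>u. p u \<in> space (cube K d)"
    and fin: "finite (set_pmf q2)"
    and sep: "\<And>u v. u \<in> A \<Longrightarrow> v \<in> set_pmf q2 \<Longrightarrow> \<delta> \<le> sup_dist K d (p u) (p v)"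
  shows "ennreal \<delta> * emeasure (measure_pmf q1) A
    \<le> wasserstein K d \<nu> (distr (measure_pmf q1) (cube K d) p) +
      wasserstein K d \<nu> (distr (measure_pmf q2) (cube K d) p)"
proof -
  define \<phi> where "\<phi> x = Min ((\<lambda>v. sup_dist K d x (p v)) ` set_pmf q2)" for x
  let ?\<mu>1 = "distr (measure_pmf q1) (cube K d) p"
  let ?\<mu>2 = "distr (measure_pmf q2) (cube K d) p"
  have pm: "p \<in> measure_pmf q \<rightarrow>\<^sub>M cube K d" for q
    using p by simp
  have "(\<lambda>x. sup_dist K d x (p v)) \<in> borel_measurable (cube K d)" for v
    by (rule measurable_sup_dist) (use p in auto)
  then have meas: "(\<lambda>x. ennreal (\<phi> x)) \<in> borel_measurable (cube K d)"
    unfolding \<phi>_def by (intro measurable_compose[OF _ measurable_ennreal] borel_measurable_Min fin)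
  have lip: "\<phi> y \<le> \<phi> x + sup_dist K d x y" for x y
  proof -
    \<comment> \<open>A support point nearest to \<open>x\<close> is a competitor in the minimum for
      \<open>y\<close>.\<close>
    have "Min ((\<lambda>v. sup_dist K d x (p v)) ` set_pmf q2) \<in> (\<lambda>v. sup_dist K d x (p v)) ` set_pmf q2"
      by (rule Min_in) (use fin set_pmf_not_empty in auto)
    then obtain v where v: "v \<in> set_pmf q2" "\<phi> x = sup_dist K d x (p v)"
      by (auto simp: \<phi>_def)
    have "\<phi> y \<le> sup_dist K d y (p v)"
      unfolding \<phi>_def by (rule Min_le) (use fin v in auto)
    also have "\<dots> \<le> sup_dist K d y x + sup_dist K d x (p v)"
      by (rule sup_dist_triangle[OF D])
    finally show ?thesis using v by (simp add: sup_dist_commute)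
  qed
  have lip': "ennreal (\<phi> y) \<le> ennreal (\<phi> x) + ennreal (sup_dist K d x y)" for x y
  proof -
    have nonneg: "sup_dist K d x y \<ge> 0" for x y
      using sup_dist_triangle[OF D, of x x y] sup_dist_commute[of K d x y] sup_dist_self[OF D, of x]
      by linarith
    have "\<phi> x \<ge> 0"
      unfolding \<phi>_def by (subst Min_ge_iff) (use fin set_pmf_not_empty nonneg in auto)
    then show ?thesis
      using lip[of y x] nonneg[of x y] by (simp add: ennreal_plus[symmetric] del: ennreal_plus)
  qed
  have "\<phi> (p v) \<le> 0" if "v \<in> set_pmf q2" for v
    unfolding \<phi>_def sup_dist_self[OF D, of "p v", symmetric]
    by (rule Min_le) (use fin that in auto)
  then have "(\<integral>\<^sup>+x. \<phi> x \<partial>?\<mu>2) = 0"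
    using meas pm[of q2] by (subst nn_integral_distr)
      (auto simp: nn_integral_0_iff_AE AE_measure_pmf_iff ennreal_neg)
  moreover have "(\<integral>\<^sup>+x. \<phi> x \<partial>\<nu>) \<le> (\<integral>\<^sup>+x. \<phi> x \<partial>?\<mu>2) + wasserstein K d ?\<mu>2 \<nu>"
    by (rule nn_integral_lipschitz_le_wasserstein[OF meas lip']) (simp only: calculation ennreal_zero_neq_top not_False_eq_True)
  ultimately have 2: "(\<integral>\<^sup>+x. \<phi> x \<partial>\<nu>) \<le> wasserstein K d \<nu> ?\<mu>2"
    by (simp only: wasserstein_commute[of K d \<nu>] add_0)
  have \<delta>: "\<delta> \<le> \<phi> (p u)" if "u \<in> A" for u
    unfolding \<phi>_def by (subst Min_ge_iff) (use fin set_pmf_not_empty sep that in auto)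
  have "ennreal \<delta> * emeasure (measure_pmf q1) A = (\<integral>\<^sup>+u. ennreal \<delta> * indicator A u \<partial>measure_pmf q1)"
    by (simp add: nn_integral_cmult_indicator)
  also have "\<dots> \<le> (\<integral>\<^sup>+u. \<phi> (p u) \<partial>measure_pmf q1)"
    by (rule nn_integral_mono) (use \<delta> in \<open>auto simp: indicator_def intro!: ennreal_leI\<close>)
  also have "\<dots> = (\<integral>\<^sup>+x. \<phi> x \<partial>?\<mu>1)"
    by (rule nn_integral_distr[symmetric, OF pm]) (use meas in simp)
  also have "\<dots> \<le> wasserstein K d \<nu> ?\<mu>1 + wasserstein K d \<nu> ?\<mu>2"
  \<comment> \<open>The Lipschitz comparison requires a finite integral against
    \<open>\<nu>\<close>, which is arbitrary; if it is infinite, fact \<open>2\<close> makes the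
    right-hand side infinite.\<close>
  proof (cases "(\<integral>\<^sup>+x. \<phi> x \<partial>\<nu>) = top")
    case True
    with 2 have "wasserstein K d \<nu> ?\<mu>2 = top" by (simp only: top_unique)
    then show ?thesis by simp
  next
    case False
    have "(\<integral>\<^sup>+x. \<phi> x \<partial>?\<mu>1) \<le> (\<integral>\<^sup>+x. \<phi> x \<partial>\<nu>) + wasserstein K d \<nu> ?\<mu>1"
      by (rule nn_integral_lipschitz_le_wasserstein[OF meas lip' False])
    also have "\<dots> \<le> wasserstein K d \<nu> ?\<mu>2 + wasserstein K d \<nu> ?\<mu>1"
      by (rule add_right_mono[OF 2])
    finally show ?thesis by (simp only: add.commute)
  qed
  finally show ?thesis .
qed

section \<open>Averaging over the choices in all pairs\<close>

text \<open>Flipping on \<open>U\<close> is an involution of \<open>Pow X\<close>, so it only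
  permutes the summands.\<close>

lemma sum_Pow_symmetric_difference:
  fixes f :: "nat set \<Rightarrow> ennreal"
  assumes "U \<subseteq> X"
  shows "(\<Sum>T\<in>Pow X. f (sym_diff T U)) = (\<Sum>T\<in>Pow X. f T)"
  by (rule sum.reindex_bij_witness[where i = "\<lambda>T. sym_diff T U" and j = "\<lambda>T. sym_diff T U"])
     (use assms in auto)

text \<open>\<open>L\<close> stands for the worst-case risk of the estimator \<open>E\<close>.
  Summing the risk over all choices \<open>T\<close> and exchanging this sum with the one over
  samples reduces the bound to one fixed sequence of sampled pairs.\<close>

lemma minimax_separated_points:
  assumes D: "(SIGMA k:{1..K}. {1..d k}) \<noteq> {}" and n: "n > 0" and \<delta>: "\<delta> > 0"
    and p: "\<And>u. p u \<in> space (cube K d)"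
    and sep: "\<And>u v. u < 4 * n \<Longrightarrow> v < 4 * n \<Longrightarrow> u \<noteq> v \<Longrightarrow> \<delta> \<le> sup_dist K d (p u) (p v)"
    and L: "\<And>q :: nat pmf. (\<integral>\<^sup>+\<omega>. wasserstein K d (E \<omega>) (distr (measure_pmf q) (cube K d) p)
              \<partial>(\<Pi>\<^sub>M m\<in>{1..n}. distr (measure_pmf q) (cube K d) p)) \<le> L"
  shows "ennreal (\<delta> / 4) \<le> L"
proof -
  define m where "m = 2 * n"
  have m: "m > 0" using n by (simp add: m_def)
  \<comment> \<open>Pair \<open>u\<close> consists of the points \<open>2 * u\<close> and
    \<open>2 * u + 1\<close>; membership in \<open>T\<close> selects the latter.\<close>
  define c where "c T u = 2 * u + of_bool (u \<in> T)" for T and u :: nat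
  define q where "q T = map_pmf (c T) (pmf_of_set {..<m})" for T
  define \<mu> where "\<mu> T = distr (measure_pmf (q T)) (cube K d) p" for T
  \<comment> \<open>Samples are indexed by sequences of pairs, the same set for every
    \<open>T\<close>, which permits the later exchange of sums. Each sequence has probability
    \<open>a\<close>.\<close>
  define S where "S = ({1..n} \<rightarrow>\<^sub>E {..<m})"
  define g where "g T s = (\<lambda>i\<in>{1..n}. p (c T (s i)))" for T s
  define W where "W T s = wasserstein K d (E (g T s)) (\<mu> T)" for T s
  define a where "a = ennreal (1 / real m) ^ n"
  have fin: "finite S" and card_S: "card S = m ^ n"
    unfolding S_def by (auto intro!: finite_PiE simp: card_PiE)
  have set_q: "set_pmf (q T) = c T ` {..<m}" for T
    unfolding q_def using m by (subst set_map_pmf, subst set_pmf_of_set) auto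
  have c_less: "c T u < 4 * n" if "u < m" for T u
    using that by (auto simp: c_def m_def)
  have c_div: "c T u div 2 = u" for T u
    by (simp add: c_def)
  have p_inj: "u = v" if "p u = p v" "u < 4 * n" "v < 4 * n" for u v
    using sep[of u v] that \<delta> sup_dist_self[OF D] by force
  \<comment> \<open>The risk is at least its part on the atoms \<open>g T s\<close>, each of mass at
    least \<open>a\<close>.\<close>
  have sample: "(\<Sum>s\<in>S. W T s * a) \<le> L" for T
  proof -
    have g_inj: "inj_on (g T) S"
    proof (rule inj_onI)
      fix s t assume st: "s \<in> S" "t \<in> S" "g T s = g T t"
      show "s = t"
      proof (rule PiE_ext[OF st(1,2)[unfolded S_def]])
        fix i assume i: "i \<in> {1..n}"
        then have "s i < m" "t i < m" using st by (auto simp: S_def dest: PiE_mem)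
        moreover have "p (c T (s i)) = p (c T (t i))"
          using fun_cong[OF st(3), of i] i by (simp add: g_def)
        ultimately have "c T (s i) = c T (t i)"
          by (intro p_inj c_less)
        then show "s i = t i" by (metis c_div)
      qed
    qed
    have single: "{p u} \<in> sets (cube K d)" for u
      by (rule singleton_sets_block_space[OF p]) simp
    have atom: "ennreal (1 / real m) \<le> emeasure (\<mu> T) {p (c T u)}" if "u < m" for u
    proof -
      have "ennreal (1 / real m) = ennreal (pmf (pmf_of_set {..<m}) u)"
        using m that by (subst pmf_of_set) auto
      also have "\<dots> = emeasure (measure_pmf (pmf_of_set {..<m})) {u}"
        by (simp add: emeasure_pmf_single)
      also have "\<dots> \<le> emeasure (measure_pmf (pmf_of_set {..<m})) (c T -` (p -` {p (c T u)}))"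
        by (rule emeasure_mono) auto
      also have "\<dots> = emeasure (measure_pmf (q T)) (p -` {p (c T u)})"
        unfolding q_def by (simp only: emeasure_map_pmf)
      also have "\<dots> = emeasure (\<mu> T) {p (c T u)}"
        unfolding \<mu>_def using single p by (subst emeasure_distr) auto
      finally show ?thesis .
    qed
    have "(\<Sum>s\<in>S. W T s * a) \<le> (\<Sum>s\<in>S. W T s * (\<Prod>i\<in>{1..n}. emeasure (\<mu> T) {g T s i}))"
    proof (intro sum_mono mult_left_mono)
      fix s assume s: "s \<in> S"
      have "a = (\<Prod>i\<in>{1..n}. ennreal (1 / real m))" by (simp add: a_def)
      also have "\<dots> \<le> (\<Prod>i\<in>{1..n}. emeasure (\<mu> T) {g T s i})"
        by (rule prod_mono_ennreal) (use s atom in \<open>auto simp: g_def S_def dest: PiE_mem\<close>)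
      finally show "a \<le> (\<Prod>i\<in>{1..n}. emeasure (\<mu> T) {g T s i})" .
    qed simp
    also have "\<dots> \<le> (\<integral>\<^sup>+\<omega>. wasserstein K d (E \<omega>) (\<mu> T) \<partial>(\<Pi>\<^sub>M m\<in>{1..n}. \<mu> T))"
      unfolding W_def
    proof (rule sum_le_nn_integral_PiM[OF _ fin _ g_inj])
      show "prob_space (\<mu> T)"
        unfolding \<mu>_def by (rule measure_pmf.prob_space_distr) (use p in auto)
    qed (use p single in \<open>auto simp: g_def \<mu>_def space_PiM\<close>)
    also have "\<dots> \<le> L" unfolding \<mu>_def by (rule L)
    finally show ?thesis .
  qed
  have pairs: "2 ^ m * ennreal (\<delta> / 4) \<le> (\<Sum>T\<in>Pow {..<m}. W T s)" if s: "s \<in> S" for s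
  proof -
    \<comment> \<open>The pairs that the sample misses, at least \<open>n\<close> of the
      \<open>2 * n\<close>.\<close>
    define U where "U = {..<m} - s ` {1..n}"
    have "card {..<m} - card (s ` {1..n}) \<le> card U"
      unfolding U_def by (rule diff_card_le_card_Diff) simp
    moreover have "card (s ` {1..n}) \<le> n"
      using card_image_le[of "{1..n}" s] by simp
    ultimately have card_U: "n \<le> card U" by (simp add: m_def)
    have step: "ennreal (\<delta> / 2) \<le> W T s + W (sym_diff T U) s" for T
    proof -
      let ?T' = "sym_diff T U"
      \<comment> \<open>Flipping unseen pairs leaves the sample, hence the estimate, unchanged: one
        estimate has to serve both \<open>\<mu> T\<close> and \<open>\<mu> ?T'\<close>.\<close>
      have g: "g ?T' s = g T s"
        unfolding g_def by (intro restrict_ext) (auto simp: c_def U_def)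
      have "1 / 2 \<le> real (card U) / m"
        using card_U m by (simp add: m_def field_simps)
      also have "\<dots> = measure (measure_pmf (pmf_of_set {..<m})) U"
        using m by (subst measure_pmf_of_set) (auto simp: U_def Int_absorb1)
      also have "\<dots> \<le> measure (measure_pmf (pmf_of_set {..<m})) (c T -` (c T ` U))"
        by (rule measure_pmf.finite_measure_mono) auto
      also have "\<dots> = measure (measure_pmf (q T)) (c T ` U)"
        unfolding q_def by (simp only: measure_map_pmf)
      finally have half: "1 / 2 \<le> measure (measure_pmf (q T)) (c T ` U)" .
      have "ennreal (\<delta> / 2) = ennreal \<delta> * ennreal (1 / 2)"
        using \<delta> by (subst ennreal_mult[symmetric]) simp_all
      also have "\<dots> \<le> ennreal \<delta> * emeasure (measure_pmf (q T)) (c T ` U)"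
        unfolding measure_pmf.emeasure_eq_measure using half by (intro mult_left_mono ennreal_leI) auto
      also have "\<dots> \<le> wasserstein K d (E (g T s)) (\<mu> T) + wasserstein K d (E (g T s)) (\<mu> ?T')"
        unfolding \<mu>_def
      proof (rule wasserstein_add_ge_separated[OF D p])
        show "finite (set_pmf (q ?T'))" by (simp add: set_q)
        fix u v assume "u \<in> c T ` U" "v \<in> set_pmf (q ?T')"
        then obtain x y where xy: "x \<in> U" "u = c T x" "y < m" "v = c ?T' y"
          by (auto simp: set_q)
        then have "x < m" by (simp add: U_def)
        \<comment> \<open>Different pairs are disjoint, and in a pair from \<open>U\<close> the
          choices \<open>T\<close> and \<open>?T'\<close> select opposite points.\<close>
        moreover have "u \<noteq> v"
        proof (cases "x = y")
          case True
          then show ?thesis using xy by (auto simp: c_def)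
        next
          case False
          then show ?thesis using xy by (metis c_div)
        qed
        ultimately show "\<delta> \<le> sup_dist K d (p u) (p v)"
          using xy by (intro sep) (auto simp: c_less)
      qed
      finally show ?thesis by (simp add: W_def g)
    qed
    \<comment> \<open>The flip permutes the choices, so summing \<open>step\<close> over all
      \<open>T\<close> counts every loss twice.\<close>
    have "2 * (2 ^ m * ennreal (\<delta> / 4)) = (\<Sum>T\<in>Pow {..<m}. ennreal (\<delta> / 2))"
      using ennreal_mult[of 2 "\<delta> / 4"] \<delta> by (simp add: card_Pow mult_ac)
    also have "\<dots> \<le> (\<Sum>T\<in>Pow {..<m}. W T s + W (sym_diff T U) s)"
      by (intro sum_mono step)
    also have "\<dots> = 2 * (\<Sum>T\<in>Pow {..<m}. W T s)"
    proof -
      have "U \<subseteq> {..<m}" by (auto simp: U_def)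
      then show ?thesis
        by (simp only: sum.distrib sum_Pow_symmetric_difference[of U "{..<m}" "\<lambda>T. W T s"] mult_2)
    qed
    finally show ?thesis
      by (simp add: ennreal_mult_le_mult_iff)
  qed
  \<comment> \<open>Inserts the total mass \<open>m ^ n * a = 1\<close> of the sequences, so that
    \<open>pairs\<close> can be averaged over them.\<close>
  have "2 ^ m * ennreal (\<delta> / 4) = (of_nat (m ^ n) * a) * (2 ^ m * ennreal (\<delta> / 4))"
  proof -
    have "of_nat (m ^ n) * a = ennreal (real m ^ n * (1 / real m) ^ n)"
      unfolding a_def by (simp add: ennreal_power ennreal_mult ennreal_of_nat_eq_real_of_nat)
    also have "real m ^ n * (1 / real m) ^ n = 1"
      using m by (simp add: power_mult_distrib[symmetric])
    finally show ?thesis by simp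
  qed
  also have "\<dots> = (\<Sum>s\<in>S. (2 ^ m * ennreal (\<delta> / 4)) * a)"
    by (simp add: card_S mult_ac)
  also have "\<dots> \<le> (\<Sum>s\<in>S. (\<Sum>T\<in>Pow {..<m}. W T s) * a)"
    by (intro sum_mono mult_right_mono pairs) auto
  also have "\<dots> = (\<Sum>T\<in>Pow {..<m}. \<Sum>s\<in>S. W T s * a)"
    by (subst sum.swap) (simp add: sum_distrib_right)
  also have "\<dots> \<le> (\<Sum>T\<in>Pow {..<m}. L)"
    by (intro sum_mono sample)
  also have "\<dots> = 2 ^ m * L"
    by (simp add: card_Pow)
  finally show ?thesis
    using ennreal_mult_le_mult_iff[of "2 ^ m" "ennreal (\<delta> / 4)" L] by (simp add: power_eq_top_ennreal)
qed

section \<open>The minimax bound: grid size and constant\<close>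

theorem corollary4p3:
  "\<exists>C::real. C > 0 \<and>
     (\<forall>(K::nat) (G::(nat \<times> nat) set) (d::nat \<Rightarrow> nat) (n::nat).
        topsorted_dag K G \<longrightarrow>
        (\<exists>!k. k \<in> {1..K} \<and> pa G k = {}) \<longrightarrow>
        (\<forall>k\<in>{1..K}. d k \<ge> 1) \<longrightarrow>
        (\<Sum>k=1..K. d k) \<ge> 3 \<longrightarrow>
        n \<ge> 8 \<longrightarrow>
        (INF E\<in>estimators K d n. SUP \<mu>\<in>P_dag K G d.
            \<integral>\<^sup>+\<omega>. wasserstein K d (E \<omega>) \<mu> \<partial>(\<Pi>\<^sub>M m\<in>{1..n}. \<mu>))
          \<ge> ennreal (C * real n powr (- 1 / real (\<Sum>k=1..K. d k))))"
proof (intro exI[of _ "1 / 64"] conjI allI impI INF_greatest)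
  fix K :: nat and G :: "(nat \<times> nat) set" and d :: "nat \<Rightarrow> nat" and n :: nat and E
  assume G: "topsorted_dag K G" "\<exists>!k. k \<in> {1..K} \<and> pa G k = {}"
    and d: "\<forall>k\<in>{1..K}. d k \<ge> 1" and sum: "(\<Sum>k=1..K. d k) \<ge> 3" and n: "n \<ge> 8"
  define D where "D = (\<Sum>k=1..K. d k)"
  have D: "D > 0" using sum by (simp add: D_def)
  \<comment> \<open>Rounding \<open>r\<close> up gives a grid whose \<open>M ^ D\<close> cells have
    room for \<open>4 * n\<close> points; \<open>r \<ge> 1\<close> keeps \<open>M\<close> below
    \<open>2 * r\<close>.\<close>
  define r where "r = real (4 * n) powr (1 / D)"
  define M where "M = nat \<lceil>r\<rceil>"
  have r1: "1 \<le> r" unfolding r_def using n by (intro ge_one_powr_ge_zero) auto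
  have rM: "r \<le> real M" "real M \<le> 2 * r" using r1 by (auto simp: M_def) linarith+
  have "real (4 * n) = r ^ D"
    using n D by (simp add: r_def powr_realpow[symmetric] powr_powr)
  also have "\<dots> \<le> real M ^ D"
    using rM r1 by (intro power_mono) auto
  finally have grid: "4 * n \<le> M ^ (\<Sum>k=1..K. d k)"
    unfolding D_def by (metis of_nat_le_iff of_nat_power)
  have "0 < 4 * n" using n by simp
  from separated_grid_points[OF this grid D[unfolded D_def]]
  obtain p h where p: "\<And>u. p u \<in> space (cube K d)"
    and h: "h \<in> borel \<rightarrow>\<^sub>M count_space UNIV"
    and decode: "\<And>u k i. k \<in> {1..K} \<Longrightarrow> i \<in> {1..d k} \<Longrightarrow> p (h (p u k i)) = p u"
    and sep: "\<And>u v. u < 4 * n \<Longrightarrow> v < 4 * n \<Longrightarrow> u \<noteq> v \<Longrightarrow> 1 / (2 * real M) \<le> sup_dist K d (p u) (p v)"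
    by atomize_elim assumption
  \<comment> \<open>Bounding \<open>4 powr (1 / D)\<close> by 4 makes the constant independent of
    the dimension.\<close>
  have "r \<le> 4 * real n powr (1 / D)"
  proof -
    have "(4::real) powr (1 / D) \<le> 4 powr 1"
      using D by (intro powr_mono) auto
    then show ?thesis
      by (simp add: r_def powr_mult mult_right_mono)
  qed
  then have "real M \<le> 8 * real n powr (1 / D)" using rM by linarith
  \<comment> \<open>The separation \<open>1 / (2 * M)\<close> yields the risk bound
    \<open>1 / (8 * M)\<close>; together with \<open>M \<le> 8 * n powr (1 / D)\<close> this gives
    the constant \<open>1 / 64\<close>.\<close>
  then have "1 / (64 * real n powr (1 / D)) \<le> 1 / (8 * real M)"
    using rM r1 n by (intro divide_left_mono mult_pos_pos) auto
  then have "1 / 64 * real n powr (- 1 / real D) \<le> 1 / (2 * real M) / 4"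
    by (simp add: powr_minus field_simps)
  then have "ennreal (1 / 64 * real n powr (- 1 / real D)) \<le> ennreal (1 / (2 * real M) / 4)"
    by (rule ennreal_leI)
  also have "\<dots> \<le> (SUP \<mu>\<in>P_dag K G d. \<integral>\<^sup>+\<omega>. wasserstein K d (E \<omega>) \<mu> \<partial>(\<Pi>\<^sub>M m\<in>{1..n}. \<mu>))"
  proof (rule minimax_separated_points[where n = n and p = p and E = E])
    show "(SIGMA k:{1..K}. {1..d k}) \<noteq> {}"
      using d topsorted_dag_root(1)[OF G] by fastforce
    \<comment> \<open>Every law of \<open>p\<close> under a random index belongs to
      \<open>P_dag K G d\<close>, so its risk is below the supremum.\<close>
    show "(\<integral>\<^sup>+\<omega>. wasserstein K d (E \<omega>) (distr (measure_pmf q) (cube K d) p)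
          \<partial>(\<Pi>\<^sub>M m\<in>{1..n}. distr (measure_pmf q) (cube K d) p))
        \<le> (SUP \<mu>\<in>P_dag K G d. \<integral>\<^sup>+\<omega>. wasserstein K d (E \<omega>) \<mu> \<partial>(\<Pi>\<^sub>M m\<in>{1..n}. \<mu>))" for q :: "nat pmf"
      by (intro SUP_upper distr_in_P_dag[OF G _ p h] decode) (use d in auto)
  qed (use p sep n rM r1 in auto)
  finally show "ennreal (1 / 64 * real n powr (- 1 / real (\<Sum>k=1..K. d k)))
      \<le> (SUP \<mu>\<in>P_dag K G d. \<integral>\<^sup>+\<omega>. wasserstein K d (E \<omega>) \<mu> \<partial>(\<Pi>\<^sub>M m\<in>{1..n}. \<mu>))"
    by (simp only: D_def)
qed simp

end
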